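(* Let $\mathcal G=(\mathcal V,\mathcal E)$ be a weakly connected multigraph with incidence matrix $A$, let $w^l\in\mathbb R_{\ge 0}^{\mathcal E}$ and $w^u\in\mathbb R_{>0}^{\mathcal E}$ be link weight bounds ($w^l\le w^u$), let $c^l\in\mathbb R_{<0}^{\mathcal E}$ and $c^u\in\mathbb R_{>0}^{\mathcal E}$ be link capacity bounds, and let $p\in\mathbb R^{\mathcal V}$ be a supply-demand vector with $\mathbf 1^{\mathrm T}p=0$. Then, with $\mathcal F_0,\mathcal F_1,\mathcal F_2$ as defined in the context, $$\mathcal F_2\subseteq \mathcal F_1\cap\mathcal F_0 .$$ Moreover: (1) if $\mathcal G$ is a tree (as an undirected graph), then $\mathcal F_1=\mathcal F_2$; (2) if $w^l=\mathbf 0$, then $\mathcal F_2=\mathcal F_1\cap\mathcal F_0$.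
   Context: $\mathcal G$ is a finite multigraph (parallel links allowed, no self-loops) whose links are given arbitrary reference directions: link $i$ goes from its tail $\sigma(i)$ to its head $\tau(i)$. The incidence matrix $A\in\{-1,0,1\}^{\mathcal V\times\mathcal E}$ has $A_{vi}=1$ if $v=\sigma(i)$, $A_{vi}=-1$ if $v=\tau(i)$, and $0$ otherwise. Vector inequalities are componentwise. Flows may have either sign. Feasible flow sets: $$\mathcal F_1:=\{f\in\mathbb R^{\mathcal E}: Af=p,\ c^l\le f\le c^u\},$$ $$\mathcal F_2:=\{f\in\mathbb R^{\mathcal E}: \exists\, w\in[w^l,w^u],\ \phi\in\mathbb R^{\mathcal V}\text{ such that } Af=p,\ c^l\le f\le c^u,\ f=\mathrm{diag}(w)A^{\mathrm T}\phi\}.$$ A cycle $\mathcal C\subseteq\mathcal E$ is a set of links forming a loop (in the underlying undirected graph) together with a direction of traversal; it splits into forward links $\mathcal C_F$ (traversed along their reference direction) and backward links $\mathcal C_B$ (traversed against it). A flow $f$ contains a circulation if there is a cycle $\mathcal C$ with $f_i>0$ for all $i\in\mathcal C_F$ and $f_i<0$ for all $i\in\mathcal C_B$. Finally, $\mathcal F_0:=\{f\in\mathbb R^{\mathcal E}: f\text{ does not contain a circulation}\}$. *)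

theory Defs
  imports Complex_Main "HOL-Library.FuncSet" "Graph_Theory.Graph_Theory"
begin

text \<open>
  A vector indexed by a finite set \<open>S\<close> of vertices or links is an element of
  \<open>S \<rightarrow>\<^sub>E (UNIV :: real set)\<close>; extensionality makes equality of sets of flows mean
  equality as subsets of the finite-dimensional space, whatever lies outside \<open>S\<close> in the type.
\<close>

text \<open>The value for a link with \<open>v = tail = head\<close> is irrelevant: graphs here have no self-loops.\<close>

definition incidence :: "('v, 'e) pre_digraph \<Rightarrow> 'v \<Rightarrow> 'e \<Rightarrow> real" where
  "incidence G v i = (if v = tail G i then 1 else if v = head G i then -1 else 0)"

definition transp_mat :: "('i \<Rightarrow> 'j \<Rightarrow> real) \<Rightarrow> 'j \<Rightarrow> 'i \<Rightarrow> real" where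
  "transp_mat M j i = M i j"

text \<open>Matrix-vector product; \<open>J\<close> is the set of column indices.\<close>

definition mat_vec :: "'j set \<Rightarrow> ('i \<Rightarrow> 'j \<Rightarrow> real) \<Rightarrow> ('j \<Rightarrow> real) \<Rightarrow> 'i \<Rightarrow> real" where
  "mat_vec J M x i = (\<Sum>j\<in>J. M i j * x j)"


text \<open>
  The bidirected version of \<open>G\<close> has two arcs per link \<open>i\<close>: \<open>(i, True)\<close> is \<open>i\<close> traversed along
  its reference direction, \<open>(i, False)\<close> is \<open>i\<close> traversed against it.
\<close>

definition bidirect :: "('v, 'e) pre_digraph \<Rightarrow> ('v, 'e \<times> bool) pre_digraph" where
  "bidirect G = \<lparr> verts = verts G, arcs = arcs G \<times> UNIV,
     tail = (\<lambda>(i, fwd). if fwd then tail G i else head G i),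
     head = (\<lambda>(i, fwd). if fwd then head G i else tail G i) \<rparr>"

text \<open>
  The library's \<^term>\<open>pre_digraph.cycle\<close> requires a nonempty closed walk without repeated
  vertices. The second conjunct excludes going back and forth over one and the same link;
  two distinct parallel links do form a cycle.
\<close>

definition undirected_cycle :: "('v, 'e) pre_digraph \<Rightarrow> ('e \<times> bool) list \<Rightarrow> bool" where
  "undirected_cycle G C \<longleftrightarrow> pre_digraph.cycle (bidirect G) C \<and> distinct (map fst C)"

definition forward_links :: "('e \<times> bool) list \<Rightarrow> 'e set" where
  "forward_links C = {i. (i, True) \<in> set C}"

definition backward_links :: "('e \<times> bool) list \<Rightarrow> 'e set" where
  "backward_links C = {i. (i, False) \<in> set C}"

definition contains_circulation :: "('v, 'e) pre_digraph \<Rightarrow> ('e \<Rightarrow> real) \<Rightarrow> bool" where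
  "contains_circulation G f \<longleftrightarrow> (\<exists>C. undirected_cycle G C \<and>
     (\<forall>i\<in>forward_links C. f i > 0) \<and> (\<forall>i\<in>backward_links C. f i < 0))"

text \<open>
  \<^const>\<open>Digraph_Component.connected\<close> is weak connectedness (it passes to the symmetric closure),
  but the library's \<^const>\<open>Digraph_Component.tree\<close> only forbids directed cycles, hence this definition.
\<close>

definition undirected_tree :: "('v, 'e) pre_digraph \<Rightarrow> bool" where
  "undirected_tree G \<longleftrightarrow> Digraph_Component.connected G \<and> \<not> (\<exists>C. undirected_cycle G C)"

definition F0 :: "('v, 'e) pre_digraph \<Rightarrow> ('e \<Rightarrow> real) set" where
  "F0 G = {f \<in> arcs G \<rightarrow>\<^sub>E UNIV. \<not> contains_circulation G f}"

definition F1 :: "('v, 'e) pre_digraph \<Rightarrow> ('v \<Rightarrow> real) \<Rightarrow> ('e \<Rightarrow> real) \<Rightarrow> ('e \<Rightarrow> real)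
    \<Rightarrow> ('e \<Rightarrow> real) set" where
  "F1 G p cl cu = {f \<in> arcs G \<rightarrow>\<^sub>E UNIV.
     (\<forall>v\<in>verts G. mat_vec (arcs G) (incidence G) f v = p v) \<and>
     (\<forall>i\<in>arcs G. cl i \<le> f i \<and> f i \<le> cu i)}"

definition F2 :: "('v, 'e) pre_digraph \<Rightarrow> ('v \<Rightarrow> real) \<Rightarrow> ('e \<Rightarrow> real) \<Rightarrow> ('e \<Rightarrow> real)
    \<Rightarrow> ('e \<Rightarrow> real) \<Rightarrow> ('e \<Rightarrow> real) \<Rightarrow> ('e \<Rightarrow> real) set" where
  "F2 G p cl cu wl wu = {f \<in> arcs G \<rightarrow>\<^sub>E UNIV.
     \<exists>w \<in> (\<Pi>\<^sub>E i\<in>arcs G. {wl i..wu i}). \<exists>\<phi> \<in> verts G \<rightarrow>\<^sub>E UNIV.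
       (\<forall>v\<in>verts G. mat_vec (arcs G) (incidence G) f v = p v) \<and>
       (\<forall>i\<in>arcs G. cl i \<le> f i \<and> f i \<le> cu i) \<and>
       (\<forall>i\<in>arcs G. f i = w i * mat_vec (verts G) (transp_mat (incidence G)) \<phi> i)}"

end

theory Submission
  imports Defs
begin

text \<open>
  Write \<open>\<Delta>\<phi> i\<close> for \<open>\<phi> (tail i) - \<phi> (head i)\<close>, which is the entry at link \<open>i\<close> of \<open>A\<^sup>T \<phi>\<close>. Traversing
  every link in the direction in which \<open>f\<close> runs through it, and discarding the links without
  flow, gives the flow digraph of \<open>f\<close>; since \<open>f\<close> has only one sign on a link, the circulations
  of \<open>f\<close> are exactly the directed cycles of this digraph (\<open>contains_circulation_iff_cycle\<close>).

  If \<open>f i = w i * \<Delta>\<phi> i\<close> with \<open>w i \<ge> 0\<close>, then \<open>\<phi>\<close> strictly decreases along every arc of the flow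
  digraph, so there is no directed cycle. This is \<open>F2 \<subseteq> F0\<close>.

  Conversely, a finite acyclic digraph has a potential that drops along each arc by at least any
  prescribed amount (\<open>acyclic_imp_potential\<close>). Prescribing \<open>\<bar>f i\<bar> / wu i\<close> on the flow digraph makes
  the weight \<open>w i = f i / \<Delta>\<phi> i\<close> lie between \<open>0\<close> and \<open>wu i\<close>; links without flow take the
  weight \<open>0\<close>. These weights may be arbitrarily small, so they respect the lower bound \<open>wl = 0\<close>
  but in general no larger one.

  On a tree there is no need to choose the weights after \<open>\<phi>\<close>: every function on the links is of
  the form \<open>\<Delta>\<phi>\<close> (\<open>no_undirected_cycle_imp_potential\<close>), so the weights can be fixed at \<open>w = wu\<close>
  and \<open>\<Delta>\<phi> = f / wu\<close> solved for \<open>\<phi>\<close>.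
\<close>

section \<open>Potentials on digraphs\<close>

lemma (in wf_digraph) decreasing_along_walk:
  fixes \<phi> :: "'a \<Rightarrow> real"
  assumes "awalk u q v" "q \<noteq> []" "\<And>a. a \<in> set q \<Longrightarrow> \<phi> (head G a) < \<phi> (tail G a)"
  shows "\<phi> v < \<phi> u"
  using assms
proof (induction q arbitrary: u)
  case (Cons a q)
  have u: "tail G a = u" and w: "awalk (head G a) q v"
    using Cons.prems(1) by (auto simp: awalk_Cons_iff)
  have "\<phi> (head G a) < \<phi> u"
    using Cons.prems(3)[of a] u by simp
  moreover have "\<phi> v \<le> \<phi> (head G a)"
  proof (cases "q = []")
    case True
    then show ?thesis using w by (simp add: awalk_Nil_iff)
  next
    case False
    then show ?thesis using Cons.IH[OF w] Cons.prems(3) by fastforce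
  qed
  ultimately show ?case by simp
qed simp

text \<open>
  Without a cycle, the number of vertices that can be reached from a vertex drops by at least one
  along every arc, because the head of the arc is reachable from its tail but not from itself.
  Scaling this number by a common bound on the prescribed drops gives the potential.
\<close>

lemma (in fin_digraph) acyclic_imp_potential:
  fixes l :: "'b \<Rightarrow> real"
  assumes acyclic: "\<not> (\<exists>C. cycle C)"
  obtains \<phi> :: "'a \<Rightarrow> real" where "\<And>a. a \<in> arcs G \<Longrightarrow> l a \<le> \<phi> (tail G a) - \<phi> (head G a)"
proof -
  define M where "M = (\<Sum>a\<in>arcs G. \<bar>l a\<bar>)"
  define r where "r v = {u. v \<rightarrow>\<^sup>+ u}" for v
  have fin: "finite (r v)" for v
    by (rule finite_subset[of _ "verts G"]) (auto simp: r_def dest: reachable1_in_verts)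
  have irrefl: "v \<notin> r v" for v
  proof
    assume "v \<in> r v"
    then obtain q where "awalk v q v" "q \<noteq> []"
      by (auto simp: r_def reachable1_awalk)
    then show False
      using closed_w_imp_cycle acyclic by (auto simp: closed_w_def)
  qed
  have drop: "card (r (head G a)) + 1 \<le> card (r (tail G a))" if a: "a \<in> arcs G" for a
  proof -
    have e: "tail G a \<rightarrow> head G a" using a by (rule in_arcs_imp_in_arcs_ends)
    then have "r (head G a) \<subseteq> r (tail G a)" "head G a \<in> r (tail G a)"
      by (auto simp: r_def)
    then have "r (head G a) \<subset> r (tail G a)" using irrefl by blast
    from psubset_card_mono[OF fin this] show ?thesis by simp
  qed
  show thesis
  proof
    fix a assume a: "a \<in> arcs G"
    have "\<bar>l a\<bar> \<le> M" unfolding M_def by (rule member_le_sum[OF a]) auto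
    moreover have "M \<ge> 0" unfolding M_def by (simp add: sum_nonneg)
    moreover have "1 \<le> real (card (r (tail G a))) - real (card (r (head G a)))"
      using drop[OF a] by linarith
    ultimately have "l a \<le> M * (real (card (r (tail G a))) - real (card (r (head G a))))"
      using mult_left_mono[of 1 "real (card (r (tail G a))) - real (card (r (head G a)))" M]
      by linarith
    then show "l a \<le> M * real (card (r (tail G a))) - M * real (card (r (head G a)))"
      by (simp add: right_diff_distrib)
  qed
qed

section \<open>Subgraphs of the bidirected graph\<close>

definition bidirect_on :: "('v, 'e) pre_digraph \<Rightarrow> ('e \<times> bool) set \<Rightarrow> ('v, 'e \<times> bool) pre_digraph"
  where "bidirect_on G X = (bidirect G)\<lparr>arcs := X\<rparr>"

lemma bidirect_on_simps [simp]:
  "verts (bidirect_on G X) = verts G"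
  "arcs (bidirect_on G X) = X"
  "tail (bidirect_on G X) a = (if snd a then tail G (fst a) else head G (fst a))"
  "head (bidirect_on G X) a = (if snd a then head G (fst a) else tail G (fst a))"
  by (simp_all add: bidirect_on_def bidirect_def split_beta)

lemma bidirect_conv_on: "bidirect G = bidirect_on G (arcs G \<times> UNIV)"
  by (simp add: bidirect_on_def bidirect_def)

lemma fin_digraph_bidirect_on:
  assumes "fin_digraph G" "X \<subseteq> arcs G \<times> UNIV"
  shows "fin_digraph (bidirect_on G X)"
proof -
  interpret fin_digraph G by fact
  show ?thesis
  proof
    show "finite (arcs (bidirect_on G X))"
      using assms(2) finite_arcs by (auto intro: finite_subset)
  qed (use assms(2) in \<open>auto intro: wellformed\<close>)
qed

lemma cas_bidirect_on:
  "pre_digraph.cas (bidirect_on G X) u q v = pre_digraph.cas (bidirect G) u q v"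
  unfolding bidirect_conv_on
  by (induction q arbitrary: u) (simp_all add: pre_digraph.cas.simps)

lemma awalk_verts_bidirect_on:
  "pre_digraph.awalk_verts (bidirect_on G X) u q = pre_digraph.awalk_verts (bidirect G) u q"
  unfolding bidirect_conv_on
  by (induction q arbitrary: u) (simp_all add: pre_digraph.awalk_verts.simps)

lemma cycle_bidirect_on_iff:
  assumes "X \<subseteq> arcs G \<times> UNIV"
  shows "pre_digraph.cycle (bidirect_on G X) C
    \<longleftrightarrow> pre_digraph.cycle (bidirect G) C \<and> set C \<subseteq> X"
  unfolding pre_digraph.cycle_def pre_digraph.awalk_def cas_bidirect_on awalk_verts_bidirect_on
  using assms by (auto simp: bidirect_def)

text \<open>
  A path visits both ends of every link that it uses, so a second use of a link, in whichever
  direction, would return to the vertex from which the link was traversed first.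
\<close>

lemma apath_imp_distinct_links:
  assumes wf: "wf_digraph (bidirect_on G X)"
    and "pre_digraph.apath (bidirect_on G X) u q v"
  shows "distinct (map fst q)"
  using assms(2)
proof (induction q arbitrary: u)
  case (Cons a q)
  interpret wf_digraph "bidirect_on G X" by (fact wf)
  have w: "apath (head (bidirect_on G X) a) q v"
    and new: "tail (bidirect_on G X) a \<notin> set (awalk_verts (head (bidirect_on G X) a) q)"
    using Cons.prems by (auto simp: apath_Cons_iff simp del: bidirect_on_simps)
  have "fst a \<notin> fst ` set q"
  proof
    assume "fst a \<in> fst ` set q"
    then obtain b where b: "b \<in> set q" "fst b = fst a" by auto
    have "tail (bidirect_on G X) b \<in> set (awalk_verts (head (bidirect_on G X) a) q)"
      "head (bidirect_on G X) b \<in> set (awalk_verts (head (bidirect_on G X) a) q)"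
      using b(1) w by (auto simp: apath_def intro: awalk_verts_arc1 awalk_verts_arc2
          simp del: bidirect_on_simps)
    moreover have "tail (bidirect_on G X) a
        \<in> {tail (bidirect_on G X) b, head (bidirect_on G X) b}"
      using b(2) by auto
    ultimately show False using new by auto
  qed
  then show ?case using Cons.IH[OF w] by simp
qed simp

section \<open>Circulations as cycles of the flow digraph\<close>

definition flow_arcs :: "('v, 'e) pre_digraph \<Rightarrow> ('e \<Rightarrow> real) \<Rightarrow> ('e \<times> bool) set" where
  "flow_arcs G f = {(i, fwd). i \<in> arcs G \<and> (if fwd then 0 < f i else f i < 0)}"

lemma flow_arcs_subset: "flow_arcs G f \<subseteq> arcs G \<times> UNIV"
  by (auto simp: flow_arcs_def)

text \<open>
  The flow digraph contains at most one of the two arcs of a link, so that a cycle in it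
  automatically uses no link twice.
\<close>

lemma contains_circulation_iff_cycle:
  assumes "fin_digraph G"
  shows "contains_circulation G f
    \<longleftrightarrow> (\<exists>C. pre_digraph.cycle (bidirect_on G (flow_arcs G f)) C)"
proof -
  interpret flow: fin_digraph "bidirect_on G (flow_arcs G f)"
    by (rule fin_digraph_bidirect_on[OF assms flow_arcs_subset])
  have sub: "flow.cycle C \<longleftrightarrow> pre_digraph.cycle (bidirect G) C \<and> set C \<subseteq> flow_arcs G f" for C
    by (rule cycle_bidirect_on_iff[OF flow_arcs_subset])
  have signs: "(\<forall>i\<in>forward_links C. f i > 0) \<and> (\<forall>i\<in>backward_links C. f i < 0)
      \<longleftrightarrow> set C \<subseteq> flow_arcs G f" if "pre_digraph.cycle (bidirect G) C" for C
  proof -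
    have "set C \<subseteq> arcs G \<times> UNIV"
      using that by (auto simp: pre_digraph.cycle_def pre_digraph.awalk_def bidirect_conv_on)
    then show ?thesis
      by (fastforce simp: flow_arcs_def forward_links_def backward_links_def split: if_splits)
  qed
  have "distinct (map fst C)" if "flow.cycle C" for C
  proof -
    have "distinct C" using that by (auto simp: flow.cycle_conv)
    moreover have "inj_on fst (flow_arcs G f)"
      by (auto simp: inj_on_def flow_arcs_def split: if_splits)
    ultimately show ?thesis
      using that by (auto simp: sub distinct_map intro: inj_on_subset)
  qed
  then show ?thesis
    unfolding contains_circulation_def undirected_cycle_def using signs sub by blast
qed

lemma mat_vec_transp_incidence:
  assumes "fin_digraph G" "loopfree_digraph G" "i \<in> arcs G"
  shows "mat_vec (verts G) (transp_mat (incidence G)) \<phi> i = \<phi> (tail G i) - \<phi> (head G i)"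
proof -
  interpret fin_digraph G by fact
  interpret loopfree_digraph G by fact
  have "mat_vec (verts G) (transp_mat (incidence G)) \<phi> i
      = (\<Sum>v\<in>verts G. (if v = tail G i then \<phi> v else 0) - (if v = head G i then \<phi> v else 0))"
    unfolding mat_vec_def transp_mat_def incidence_def
    using no_loops[OF assms(3)] by (intro sum.cong) auto
  also have "\<dots> = \<phi> (tail G i) - \<phi> (head G i)"
    using assms(3) by (simp add: sum_subtractf)
  finally show ?thesis .
qed

lemma potential_flow_no_circulation:
  assumes "fin_digraph G"
    and nonneg: "\<And>i. i \<in> arcs G \<Longrightarrow> 0 \<le> w i"
    and flow: "\<And>i. i \<in> arcs G \<Longrightarrow> f i = w i * (\<phi> (tail G i) - \<phi> (head G i))"
  shows "\<not> contains_circulation G f"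
proof
  interpret flow: fin_digraph "bidirect_on G (flow_arcs G f)"
    by (rule fin_digraph_bidirect_on[OF assms(1) flow_arcs_subset])
  assume "contains_circulation G f"
  then obtain C u where walk: "flow.awalk u C u" and "C \<noteq> []"
    by (auto simp: contains_circulation_iff_cycle[OF assms(1)] flow.cycle_def)
  moreover have "\<phi> (head (bidirect_on G (flow_arcs G f)) a)
      < \<phi> (tail (bidirect_on G (flow_arcs G f)) a)" if "a \<in> set C" for a
  proof -
    have "a \<in> flow_arcs G f" using walk that by (auto simp: flow.awalk_def)
    then show ?thesis
      using nonneg[of "fst a"] flow[of "fst a"]
      by (cases a)
        (auto simp: flow_arcs_def zero_less_mult_iff mult_less_0_iff split: if_splits)
  qed
  ultimately have "\<phi> u < \<phi> u" by (rule flow.decreasing_along_walk)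
  then show False by simp
qed

lemma no_circulation_imp_potential:
  fixes l :: "'e \<Rightarrow> real"
  assumes "fin_digraph G" "\<not> contains_circulation G f"
  obtains \<phi> :: "'v \<Rightarrow> real" where
    "\<And>i. i \<in> arcs G \<Longrightarrow> 0 < f i \<Longrightarrow> l i \<le> \<phi> (tail G i) - \<phi> (head G i)"
    "\<And>i. i \<in> arcs G \<Longrightarrow> f i < 0 \<Longrightarrow> l i \<le> \<phi> (head G i) - \<phi> (tail G i)"
proof -
  interpret flow: fin_digraph "bidirect_on G (flow_arcs G f)"
    by (rule fin_digraph_bidirect_on[OF assms(1) flow_arcs_subset])
  have "\<not> (\<exists>C. flow.cycle C)"
    using assms by (simp add: contains_circulation_iff_cycle)
  then obtain \<phi> :: "'v \<Rightarrow> real" where \<phi>: "\<And>a. a \<in> flow_arcs G f \<Longrightarrow> (l \<circ> fst) a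
      \<le> \<phi> (tail (bidirect_on G (flow_arcs G f)) a) - \<phi> (head (bidirect_on G (flow_arcs G f)) a)"
    using flow.acyclic_imp_potential[of "l \<circ> fst"] by auto
  show thesis
    by (rule that[of \<phi>]) (use \<phi>[of "(_, True)"] \<phi>[of "(_, False)"] in \<open>auto simp: flow_arcs_def\<close>)
qed

section \<open>Potentials on forests\<close>

text \<open>
  Links are added one at a time. A new link joins two different components of the links so far,
  since otherwise a path between its ends would close to a cycle; shifting the potential by a
  constant on the component of its head achieves the prescribed difference on the new link and
  changes none of the others.
\<close>

lemma no_undirected_cycle_imp_potential:
  fixes d :: "'e \<Rightarrow> real"
  assumes "fin_digraph G" and acyclic: "\<not> (\<exists>C. undirected_cycle G C)"
  obtains \<phi> :: "'v \<Rightarrow> real" where "\<And>i. i \<in> arcs G \<Longrightarrow> \<phi> (tail G i) - \<phi> (head G i) = d i"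
proof -
  interpret fin_digraph G by fact
  have "\<exists>\<phi> :: 'v \<Rightarrow> real. \<forall>i\<in>B. \<phi> (tail G i) - \<phi> (head G i) = d i"
    if "finite B" "B \<subseteq> arcs G" for B
    using that
  proof (induction B rule: finite_induct)
    case (insert i B)
    then obtain \<phi> :: "'v \<Rightarrow> real" where \<phi>: "\<And>j. j \<in> B \<Longrightarrow> \<phi> (tail G j) - \<phi> (head G j) = d j"
      by auto
    let ?H = "bidirect_on G (B \<times> UNIV)"
    have i: "i \<in> arcs G" and B: "B \<times> UNIV \<subseteq> arcs G \<times> (UNIV :: bool set)"
      using insert.prems by auto
    interpret H: fin_digraph ?H by (rule fin_digraph_bidirect_on[OF assms(1) B])
    have separate: "\<not> head G i \<rightarrow>\<^sup>*\<^bsub>?H\<^esub> tail G i"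
    proof
      assume "head G i \<rightarrow>\<^sup>*\<^bsub>?H\<^esub> tail G i"
      then obtain q where q: "H.apath (head G i) q (tail G i)"
        by (auto simp: H.reachable_apath)
      let ?C = "(i, True) # q" and ?K = "bidirect G"
      have qB: "set q \<subseteq> B \<times> UNIV"
        using q by (auto simp: H.apath_def H.awalk_def)
      have "pre_digraph.cycle ?K ?C"
        unfolding pre_digraph.cycle_def
      proof (intro exI conjI)
        show "pre_digraph.awalk ?K (tail G i) ?C (tail G i)"
          using q qB B i unfolding H.apath_def H.awalk_def
          by (auto simp: pre_digraph.awalk_def pre_digraph.cas.simps cas_bidirect_on bidirect_def)
        show "distinct (tl (pre_digraph.awalk_verts ?K (tail G i) ?C))"
          using q unfolding H.apath_def
          by (simp add: pre_digraph.awalk_verts.simps awalk_verts_bidirect_on)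
            (simp add: bidirect_def)
      qed simp
      moreover have "distinct (map fst ?C)"
        using apath_imp_distinct_links[OF H.wf_digraph q] qB insert.hyps(2) by auto
      ultimately show False
        using acyclic by (auto simp: undirected_cycle_def)
    qed
    \<comment> \<open>Reachability may be read as directed here: the graph contains both arcs of each link.\<close>
    define \<phi>' where "\<phi>' v = (if head G i \<rightarrow>\<^sup>*\<^bsub>?H\<^esub> v
      then \<phi> v + (\<phi> (tail G i) - \<phi> (head G i) - d i) else \<phi> v)" for v
    have "\<phi>' (tail G j) - \<phi>' (head G j) = d j" if j: "j \<in> B" for j
    proof -
      have "tail G j \<rightarrow>\<^bsub>?H\<^esub> head G j" "head G j \<rightarrow>\<^bsub>?H\<^esub> tail G j"
        using j H.in_arcs_imp_in_arcs_ends[of "(j, True)"]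
          H.in_arcs_imp_in_arcs_ends[of "(j, False)"]
        by auto
      then have "head G i \<rightarrow>\<^sup>*\<^bsub>?H\<^esub> tail G j \<longleftrightarrow> head G i \<rightarrow>\<^sup>*\<^bsub>?H\<^esub> head G j"
        by (blast intro: H.reachable_adj_trans)
      then show ?thesis using \<phi>[OF j] by (simp add: \<phi>'_def)
    qed
    moreover have "\<phi>' (tail G i) - \<phi>' (head G i) = d i"
    proof -
      have "head G i \<rightarrow>\<^sup>*\<^bsub>?H\<^esub> head G i" using i by (intro H.reachable_refl) simp
      then show ?thesis using separate by (simp add: \<phi>'_def)
    qed
    ultimately show ?case by blast
  qed auto
  from this[OF finite_arcs subset_refl] obtain \<phi> :: "'v \<Rightarrow> real"
    where "\<forall>i\<in>arcs G. \<phi> (tail G i) - \<phi> (head G i) = d i"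
    by blast
  then show thesis by (intro that[of \<phi>]) simp
qed

section \<open>Feasible flow sets\<close>

text \<open>
  Weights and potentials as total functions can be cut down to links and vertices because the
  defining conditions read them only there.
\<close>

lemma F2I:
  assumes "fin_digraph G" "loopfree_digraph G" "f \<in> F1 G p cl cu"
    and "\<And>i. i \<in> arcs G \<Longrightarrow> wl i \<le> w i \<and> w i \<le> wu i"
    and "\<And>i. i \<in> arcs G \<Longrightarrow> f i = w i * (\<phi> (tail G i) - \<phi> (head G i))"
  shows "f \<in> F2 G p cl cu wl wu"
proof -
  interpret fin_digraph G by fact
  have "restrict w (arcs G) \<in> (\<Pi>\<^sub>E i\<in>arcs G. {wl i..wu i})"
    using assms(4) by auto
  moreover have "restrict \<phi> (verts G) \<in> verts G \<rightarrow>\<^sub>E UNIV" by auto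
  moreover have "\<forall>i\<in>arcs G. f i = restrict w (arcs G) i
      * mat_vec (verts G) (transp_mat (incidence G)) (restrict \<phi> (verts G)) i"
    using assms(5) by (simp add: mat_vec_transp_incidence[OF assms(1,2)])
  ultimately show ?thesis
    using assms(3) unfolding F1_def F2_def by blast
qed

lemma F2_subset_F1: "F2 G p cl cu wl wu \<subseteq> F1 G p cl cu"
  by (auto simp: F1_def F2_def)

lemma F2_subset_F0:
  assumes "fin_digraph G" "loopfree_digraph G" "\<forall>i\<in>arcs G. 0 \<le> wl i"
  shows "F2 G p cl cu wl wu \<subseteq> F0 G"
proof
  fix f assume "f \<in> F2 G p cl cu wl wu"
  then obtain w \<phi> where f: "f \<in> arcs G \<rightarrow>\<^sub>E UNIV" and w: "w \<in> (\<Pi>\<^sub>E i\<in>arcs G. {wl i..wu i})"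
    and eq: "\<forall>i\<in>arcs G. f i = w i * mat_vec (verts G) (transp_mat (incidence G)) \<phi> i"
    unfolding F2_def by blast
  have "0 \<le> w i" if "i \<in> arcs G" for i
    using PiE_mem[OF w that] assms(3) that by force
  then have "\<not> contains_circulation G f"
    by (rule potential_flow_no_circulation[OF assms(1)])
      (simp_all add: eq mat_vec_transp_incidence[OF assms(1,2)])
  then show "f \<in> F0 G" using f by (simp add: F0_def)
qed

lemma F1_subset_F2_if_no_cycle:
  assumes "fin_digraph G" "loopfree_digraph G" "\<forall>i\<in>arcs G. 0 < wu i" "\<forall>i\<in>arcs G. wl i \<le> wu i"
    and "\<not> (\<exists>C. undirected_cycle G C)"
  shows "F1 G p cl cu \<subseteq> F2 G p cl cu wl wu"
proof
  fix f assume f: "f \<in> F1 G p cl cu"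
  obtain \<phi> where \<phi>: "\<And>i. i \<in> arcs G \<Longrightarrow> \<phi> (tail G i) - \<phi> (head G i) = f i / wu i"
    using no_undirected_cycle_imp_potential[OF assms(1,5), of "\<lambda>i. f i / wu i"] by blast
  have "f i = wu i * (\<phi> (tail G i) - \<phi> (head G i))" if "i \<in> arcs G" for i
    using \<phi>[OF that] assms(3) that by force
  then show "f \<in> F2 G p cl cu wl wu"
    using assms(4) by (intro F2I[OF assms(1,2) f, of _ wu]) auto
qed

lemma F1_F0_subset_F2_if_zero_lower_weights:
  assumes "fin_digraph G" "loopfree_digraph G" "\<forall>i\<in>arcs G. 0 < wu i" "\<forall>i\<in>arcs G. wl i = 0"
  shows "F1 G p cl cu \<inter> F0 G \<subseteq> F2 G p cl cu wl wu"
proof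
  fix f assume "f \<in> F1 G p cl cu \<inter> F0 G"
  then have f: "f \<in> F1 G p cl cu" and no_circ: "\<not> contains_circulation G f"
    by (auto simp: F0_def)
  obtain \<phi> where \<phi>:
    "\<And>i. i \<in> arcs G \<Longrightarrow> 0 < f i \<Longrightarrow> \<bar>f i\<bar> / wu i \<le> \<phi> (tail G i) - \<phi> (head G i)"
    "\<And>i. i \<in> arcs G \<Longrightarrow> f i < 0 \<Longrightarrow> \<bar>f i\<bar> / wu i \<le> \<phi> (head G i) - \<phi> (tail G i)"
    using no_circulation_imp_potential[OF assms(1) no_circ, of "\<lambda>i. \<bar>f i\<bar> / wu i"] by blast
  \<comment> \<open>The numerator makes this \<open>0\<close> on links without flow, whatever the potential difference is.\<close>
  define w where "w i = f i / (\<phi> (tail G i) - \<phi> (head G i))" for i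
  have "0 \<le> w i \<and> w i \<le> wu i \<and> f i = w i * (\<phi> (tail G i) - \<phi> (head G i))"
    if i: "i \<in> arcs G" for i
  proof -
    let ?d = "\<phi> (tail G i) - \<phi> (head G i)"
    have wu: "0 < wu i" using assms(3) i by blast
    consider "f i = 0" | "0 < f i" | "f i < 0" by linarith
    then show ?thesis
    proof cases
      case 1
      then show ?thesis using wu by (simp add: w_def)
    next
      case 2
      have drop: "f i / wu i \<le> ?d" using \<phi>(1)[OF i 2] 2 by simp
      then have "0 < ?d" using divide_pos_pos[OF 2 wu] by linarith
      moreover have "f i \<le> wu i * ?d"
        using drop unfolding pos_divide_le_eq[OF wu] by (simp only: mult.commute)
      ultimately show ?thesis using 2 unfolding w_def by (simp add: pos_divide_le_eq)
    next
      case 3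
      have drop: "?d \<le> f i / wu i" using \<phi>(2)[OF i 3] 3 by simp
      then have "?d < 0" using divide_neg_pos[OF 3 wu] by linarith
      moreover have "wu i * ?d \<le> f i"
        using drop unfolding pos_le_divide_eq[OF wu] by (simp only: mult.commute)
      ultimately show ?thesis using 3 unfolding w_def
        by (simp add: neg_divide_le_eq zero_le_divide_iff)
    qed
  qed
  then show "f \<in> F2 G p cl cu wl wu"
    using assms(4) by (intro F2I[OF assms(1,2) f, of _ w _ \<phi>]) auto
qed

theorem proposition1:
  fixes G :: "('v, 'e) pre_digraph"
    and wl wu cl cu :: "'e \<Rightarrow> real"
    and p :: "'v \<Rightarrow> real"
  assumes "fin_digraph G" and "loopfree_digraph G"
    and "Digraph_Component.connected G"
    and "\<forall>i\<in>arcs G. 0 \<le> wl i"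
    and "\<forall>i\<in>arcs G. 0 < wu i"
    and "\<forall>i\<in>arcs G. wl i \<le> wu i"
    and "\<forall>i\<in>arcs G. cl i < 0"
    and "\<forall>i\<in>arcs G. 0 < cu i"
    and "(\<Sum>v\<in>verts G. p v) = 0"
  shows "F2 G p cl cu wl wu \<subseteq> F1 G p cl cu \<inter> F0 G
    \<and> (undirected_tree G \<longrightarrow> F1 G p cl cu = F2 G p cl cu wl wu)
    \<and> ((\<forall>i\<in>arcs G. wl i = 0) \<longrightarrow> F2 G p cl cu wl wu = F1 G p cl cu \<inter> F0 G)"
  using F2_subset_F1[of G p cl cu wl wu] F2_subset_F0[OF assms(1,2,4), of p cl cu wu]
    F1_subset_F2_if_no_cycle[OF assms(1,2,5,6), of p cl cu]
    F1_F0_subset_F2_if_zero_lower_weights[OF assms(1,2,5), of wl p cl cu]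
  unfolding undirected_tree_def by blast

end
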